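(* Let $\mathcal C$ be a prenormal category. Let $m\colon M\to A$ and $n\colon N\to A$ be normal monomorphisms in $\mathcal C$, with $n$ factoring through $m$, say $n=m\circ j$ with $j\colon N\to M$. Then the morphism $M/N\to A/N$ induced by $m$ on the cokernels of $j$ and $n$ is a normal monomorphism, and its cokernel $(A/N)/(M/N)$ is canonically isomorphic to the cokernel $A/M$ of $m$.
   Context: A pointed category is a category with a zero object. In a pointed category, a normal epimorphism is a morphism that is a cokernel of some morphism, and a normal monomorphism is a morphism that is a kernel of some morphism. For a normal monomorphism $X\to Y$, $Y/X$ denotes the codomain of its cokernel. In the claim, $j$ is automatically a normal monomorphism (it is the pullback of $n$ along $m$), so $M/N$ is defined. A prenormal category is a pointed category $\mathcal C$ such that: (1) $\mathcal C$ has finite limits; (2) $\mathcal C$ has cokernels of kernels (every morphism which is a kernel has a cokernel); (3) normal epimorphisms are pullback-stable in $\mathcal C$ (the pullback of a normal epimorphism along any morphism is a normal epimorphism). *)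

theory Defs
  imports Main
begin

text \<open>
  The values of \<open>Dom\<close>, \<open>Cod\<close>, \<open>Id\<close> and \<open>Comp\<close> are relevant only on \<open>Obj\<close>, on \<open>Arr\<close> and on
  composable pairs. Composition is written in application order.
\<close>

record ('o, 'a) cat =
  Obj :: "'o set"
  Arr :: "'a set"
  Dom :: "'a \<Rightarrow> 'o"
  Cod :: "'a \<Rightarrow> 'o"
  Id :: "'o \<Rightarrow> 'a"
  Comp :: "'a \<Rightarrow> 'a \<Rightarrow> 'a"  (infixr "\<cdot>\<index>" 70)

definition hom :: "('o, 'a, 'z) cat_scheme \<Rightarrow> 'o \<Rightarrow> 'o \<Rightarrow> 'a set" where
  "hom C X Y = {f \<in> Arr C. Dom C f = X \<and> Cod C f = Y}"

locale category =
  fixes C :: "('o, 'a, 'z) cat_scheme" (structure)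
  assumes dom_in_Obj: "f \<in> Arr C \<Longrightarrow> Dom C f \<in> Obj C"
    and cod_in_Obj: "f \<in> Arr C \<Longrightarrow> Cod C f \<in> Obj C"
    and id_in_hom: "X \<in> Obj C \<Longrightarrow> Id C X \<in> hom C X X"
    and comp_in_hom: "f \<in> hom C X Y \<Longrightarrow> g \<in> hom C Y Z \<Longrightarrow> g \<cdot> f \<in> hom C X Z"
    and comp_id: "f \<in> hom C X Y \<Longrightarrow> f \<cdot> Id C X = f"
    and id_comp: "f \<in> hom C X Y \<Longrightarrow> Id C Y \<cdot> f = f"
    and comp_assoc: "f \<in> hom C W X \<Longrightarrow> g \<in> hom C X Y \<Longrightarrow> h \<in> hom C Y Z
      \<Longrightarrow> (h \<cdot> g) \<cdot> f = h \<cdot> (g \<cdot> f)"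

definition is_iso :: "('o, 'a, 'z) cat_scheme \<Rightarrow> 'a \<Rightarrow> bool" where
  "is_iso C f \<longleftrightarrow> f \<in> Arr C \<and>
    (\<exists>g \<in> hom C (Cod C f) (Dom C f).
      g \<cdot>\<^bsub>C\<^esub> f = Id C (Dom C f) \<and> f \<cdot>\<^bsub>C\<^esub> g = Id C (Cod C f))"

subsection \<open>Finite limits\<close>

definition is_functor ::
  "('i, 'b, 'y) cat_scheme \<Rightarrow> ('o, 'a, 'z) cat_scheme \<Rightarrow> ('i \<Rightarrow> 'o) \<Rightarrow> ('b \<Rightarrow> 'a) \<Rightarrow> bool" where
  "is_functor J C FO FA \<longleftrightarrow>
    (\<forall>i \<in> Obj J. FO i \<in> Obj C) \<and>
    (\<forall>b \<in> Arr J. FA b \<in> hom C (FO (Dom J b)) (FO (Cod J b))) \<and>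
    (\<forall>i \<in> Obj J. FA (Id J i) = Id C (FO i)) \<and>
    (\<forall>b \<in> Arr J. \<forall>c \<in> Arr J. Cod J b = Dom J c \<longrightarrow> FA (c \<cdot>\<^bsub>J\<^esub> b) = FA c \<cdot>\<^bsub>C\<^esub> FA b)"

definition is_cone ::
  "('i, 'b, 'y) cat_scheme \<Rightarrow> ('o, 'a, 'z) cat_scheme \<Rightarrow> ('i \<Rightarrow> 'o) \<Rightarrow> ('b \<Rightarrow> 'a)
    \<Rightarrow> 'o \<Rightarrow> ('i \<Rightarrow> 'a) \<Rightarrow> bool" where
  "is_cone J C FO FA L l \<longleftrightarrow>
    L \<in> Obj C \<and>
    (\<forall>i \<in> Obj J. l i \<in> hom C L (FO i)) \<and>
    (\<forall>b \<in> Arr J. FA b \<cdot>\<^bsub>C\<^esub> l (Dom J b) = l (Cod J b))"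

definition is_limit ::
  "('i, 'b, 'y) cat_scheme \<Rightarrow> ('o, 'a, 'z) cat_scheme \<Rightarrow> ('i \<Rightarrow> 'o) \<Rightarrow> ('b \<Rightarrow> 'a)
    \<Rightarrow> 'o \<Rightarrow> ('i \<Rightarrow> 'a) \<Rightarrow> bool" where
  "is_limit J C FO FA L l \<longleftrightarrow>
    is_cone J C FO FA L l \<and>
    (\<forall>X k. is_cone J C FO FA X k \<longrightarrow>
      (\<exists>!t. t \<in> hom C X L \<and> (\<forall>i \<in> Obj J. l i \<cdot>\<^bsub>C\<^esub> t = k i)))"

text \<open>
  Every finite category is isomorphic to one whose objects and arrows are natural numbers, so
  quantifying over index categories on \<^typ>\<open>nat\<close> covers all finite diagrams.
\<close>

definition has_finite_limits :: "('o, 'a, 'z) cat_scheme \<Rightarrow> bool" where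
  "has_finite_limits C \<longleftrightarrow>
    (\<forall>(J :: (nat, nat) cat) FO FA.
      category J \<longrightarrow> finite (Obj J) \<longrightarrow> finite (Arr J) \<longrightarrow> is_functor J C FO FA \<longrightarrow>
      (\<exists>L l. is_limit J C FO FA L l))"

text \<open>
  The square \<open>f \<cdot> p = g \<cdot> q\<close> is a pullback; \<open>q\<close> is the pullback of \<open>f\<close> along \<open>g\<close>.
\<close>

definition is_pullback :: "('o, 'a, 'z) cat_scheme \<Rightarrow> 'a \<Rightarrow> 'a \<Rightarrow> 'a \<Rightarrow> 'a \<Rightarrow> bool" where
  "is_pullback C f g p q \<longleftrightarrow>
    f \<in> Arr C \<and> g \<in> Arr C \<and> Cod C f = Cod C g \<and>
    p \<in> Arr C \<and> q \<in> Arr C \<and> Dom C p = Dom C q \<and>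
    Cod C p = Dom C f \<and> Cod C q = Dom C g \<and>
    f \<cdot>\<^bsub>C\<^esub> p = g \<cdot>\<^bsub>C\<^esub> q \<and>
    (\<forall>X. \<forall>h \<in> hom C X (Dom C f). \<forall>k \<in> hom C X (Dom C g). f \<cdot>\<^bsub>C\<^esub> h = g \<cdot>\<^bsub>C\<^esub> k \<longrightarrow>
      (\<exists>!t. t \<in> hom C X (Dom C p) \<and> p \<cdot>\<^bsub>C\<^esub> t = h \<and> q \<cdot>\<^bsub>C\<^esub> t = k))"

subsection \<open>Pointed categories, kernels and cokernels\<close>

definition is_zero_object :: "('o, 'a, 'z) cat_scheme \<Rightarrow> 'o \<Rightarrow> bool" where
  "is_zero_object C Z \<longleftrightarrow>
    Z \<in> Obj C \<and> (\<forall>X \<in> Obj C. (\<exists>!f. f \<in> hom C X Z) \<and> (\<exists>!f. f \<in> hom C Z X))"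

locale pointed_category = category +
  assumes has_zero_object: "\<exists>Z. is_zero_object C Z"

definition is_zero_arr :: "('o, 'a, 'z) cat_scheme \<Rightarrow> 'a \<Rightarrow> bool" where
  "is_zero_arr C f \<longleftrightarrow> f \<in> Arr C \<and>
    (\<exists>Z. is_zero_object C Z \<and>
      (\<exists>a \<in> hom C (Dom C f) Z. \<exists>b \<in> hom C Z (Cod C f). f = b \<cdot>\<^bsub>C\<^esub> a))"

text \<open>\<open>is_kernel C f k\<close>: the arrow \<open>k\<close> is a kernel of \<open>f\<close>; likewise for \<open>is_cokernel C f q\<close>.\<close>

definition is_kernel :: "('o, 'a, 'z) cat_scheme \<Rightarrow> 'a \<Rightarrow> 'a \<Rightarrow> bool" where
  "is_kernel C f k \<longleftrightarrow>
    f \<in> Arr C \<and> k \<in> Arr C \<and> Cod C k = Dom C f \<and> is_zero_arr C (f \<cdot>\<^bsub>C\<^esub> k) \<and>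
    (\<forall>X. \<forall>h \<in> hom C X (Dom C f). is_zero_arr C (f \<cdot>\<^bsub>C\<^esub> h) \<longrightarrow>
      (\<exists>!t. t \<in> hom C X (Dom C k) \<and> k \<cdot>\<^bsub>C\<^esub> t = h))"

definition is_cokernel :: "('o, 'a, 'z) cat_scheme \<Rightarrow> 'a \<Rightarrow> 'a \<Rightarrow> bool" where
  "is_cokernel C f q \<longleftrightarrow>
    f \<in> Arr C \<and> q \<in> Arr C \<and> Dom C q = Cod C f \<and> is_zero_arr C (q \<cdot>\<^bsub>C\<^esub> f) \<and>
    (\<forall>X. \<forall>h \<in> hom C (Cod C f) X. is_zero_arr C (h \<cdot>\<^bsub>C\<^esub> f) \<longrightarrow>
      (\<exists>!t. t \<in> hom C (Cod C q) X \<and> t \<cdot>\<^bsub>C\<^esub> q = h))"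

definition normal_mono :: "('o, 'a, 'z) cat_scheme \<Rightarrow> 'a \<Rightarrow> bool" where
  "normal_mono C k \<longleftrightarrow> (\<exists>f. is_kernel C f k)"

definition normal_epi :: "('o, 'a, 'z) cat_scheme \<Rightarrow> 'a \<Rightarrow> bool" where
  "normal_epi C q \<longleftrightarrow> (\<exists>f. is_cokernel C f q)"

locale prenormal_category = pointed_category +
  assumes finite_limits: "has_finite_limits C"
    and cokernels_of_kernels: "normal_mono C k \<Longrightarrow> \<exists>q. is_cokernel C k q"
    and normal_epi_pullback_stable: "is_pullback C f g p q \<Longrightarrow> normal_epi C f \<Longrightarrow> normal_epi C q"

end

theory Submission
  imports Defs
begin

text \<open>
  Write \<open>qn : A \<rightarrow> A/N\<close>, \<open>qm : A \<rightarrow> A/M\<close> and \<open>qj : M \<rightarrow> M/N\<close> for the cokernels. As \<open>qm\<close>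
  annihilates \<open>n = m \<cdot> j\<close>, it factors as \<open>qm = p \<cdot> qn\<close>. Let \<open>k : K \<rightarrow> A/N\<close> be the kernel of
  \<open>p\<close>. The inverse image of \<open>K\<close> under \<open>qn\<close> is the kernel of \<open>p \<cdot> qn = qm\<close>, that is \<open>M\<close>
  (lemma \<open>pullback_of_kernel\<close>). Pullback stability therefore makes the induced arrow
  \<open>e : M \<rightarrow> K\<close>, with \<open>k \<cdot> e = qn \<cdot> m\<close>, a normal epimorphism. Since \<open>k\<close> is monic, \<open>e\<close> has the
  same kernel as \<open>qn \<cdot> m\<close>, and this kernel is \<open>j\<close> because \<open>m\<close> is monic. A normal epimorphism is the
  cokernel of its kernel, so \<open>e\<close> is a cokernel of \<open>j\<close>: up to an isomorphism \<open>K = M/N\<close> and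
  \<open>k\<close> is the comparison \<open>M/N \<rightarrow> A/N\<close>, which is thus a kernel (of \<open>p\<close>).

  For \<open>(A/N)/(M/N)\<close>, universal properties suffice: an arrow out of \<open>A\<close> that kills \<open>M\<close> kills
  \<open>N\<close>, so it descends to \<open>A/N\<close>, where it kills \<open>M/N\<close> because \<open>qj\<close> is epic. Hence
  \<open>A \<rightarrow> A/N \<rightarrow> (A/N)/(M/N)\<close> is itself a cokernel of \<open>m\<close> (lemma \<open>cokernel_of_comp\<close>), and two
  cokernels of the same arrow are isomorphic in a unique compatible way.
\<close>

section \<open>Zero arrows, monics and epics\<close>

definition monic :: "('o, 'a, 'z) cat_scheme \<Rightarrow> 'a \<Rightarrow> bool" where
  "monic C m \<longleftrightarrow> m \<in> Arr C \<and>
    (\<forall>X. \<forall>s \<in> hom C X (Dom C m). \<forall>t \<in> hom C X (Dom C m).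
      m \<cdot>\<^bsub>C\<^esub> s = m \<cdot>\<^bsub>C\<^esub> t \<longrightarrow> s = t)"

definition epic :: "('o, 'a, 'z) cat_scheme \<Rightarrow> 'a \<Rightarrow> bool" where
  "epic C e \<longleftrightarrow> e \<in> Arr C \<and>
    (\<forall>Y. \<forall>s \<in> hom C (Cod C e) Y. \<forall>t \<in> hom C (Cod C e) Y.
      s \<cdot>\<^bsub>C\<^esub> e = t \<cdot>\<^bsub>C\<^esub> e \<longrightarrow> s = t)"

lemma in_hom_iff: "f \<in> hom C X Y \<longleftrightarrow> f \<in> Arr C \<and> Dom C f = X \<and> Cod C f = Y"
  by (simp add: hom_def)

lemma monicD:
  assumes "monic C m" "m \<in> hom C X Y" "s \<in> hom C W X" "t \<in> hom C W X"
    and "m \<cdot>\<^bsub>C\<^esub> s = m \<cdot>\<^bsub>C\<^esub> t"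
  shows "s = t"
  using assms by (auto simp: monic_def in_hom_iff)

lemma epicD:
  assumes "epic C e" "e \<in> hom C X Y" "s \<in> hom C Y Z" "t \<in> hom C Y Z"
    and "s \<cdot>\<^bsub>C\<^esub> e = t \<cdot>\<^bsub>C\<^esub> e"
  shows "s = t"
  using assms by (auto simp: epic_def in_hom_iff)

context category
begin

lemma hom_Obj:
  assumes "f \<in> hom C X Y"
  shows "X \<in> Obj C" "Y \<in> Obj C"
  using assms dom_in_Obj cod_in_Obj by (auto simp: in_hom_iff)

lemma is_isoI:
  assumes "f \<in> hom C X Y" "g \<in> hom C Y X" "g \<cdot> f = Id C X" "f \<cdot> g = Id C Y"
  shows "is_iso C f"
  using assms by (auto simp: is_iso_def in_hom_iff)

lemma zero_object_terminal:
  assumes "is_zero_object C Z" "X \<in> Obj C"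
  shows "\<exists>!f. f \<in> hom C X Z"
  using assms by (simp add: is_zero_object_def)

lemma zero_object_initial:
  assumes "is_zero_object C Z" "X \<in> Obj C"
  shows "\<exists>!f. f \<in> hom C Z X"
  using assms by (simp add: is_zero_object_def)

lemma zero_arrD:
  assumes "is_zero_arr C f" "f \<in> hom C X Y"
  obtains Z a b where "is_zero_object C Z" "a \<in> hom C X Z" "b \<in> hom C Z Y" "f = b \<cdot> a"
  using assms by (auto simp: is_zero_arr_def in_hom_iff)

lemma zero_arrI:
  assumes "is_zero_object C Z" "a \<in> hom C X Z" "b \<in> hom C Z Y"
  shows "is_zero_arr C (b \<cdot> a)"
proof -
  have "b \<cdot> a \<in> Arr C" "Dom C (b \<cdot> a) = X" "Cod C (b \<cdot> a) = Y"
    using comp_in_hom[OF assms(2,3)] by (simp_all add: in_hom_iff)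
  then show ?thesis
    using assms unfolding is_zero_arr_def by blast
qed

lemma zero_comp_right:
  assumes "is_zero_arr C f" "f \<in> hom C X Y" "g \<in> hom C W X"
  shows "is_zero_arr C (f \<cdot> g)"
proof -
  obtain Z a b where Z: "is_zero_object C Z" "a \<in> hom C X Z" "b \<in> hom C Z Y" "f = b \<cdot> a"
    using assms(1,2) by (rule zero_arrD)
  have "f \<cdot> g = b \<cdot> (a \<cdot> g)"
    using comp_assoc[OF assms(3) Z(2,3)] Z(4) by simp
  then show ?thesis
    using zero_arrI[OF Z(1) comp_in_hom[OF assms(3) Z(2)] Z(3)] by simp
qed

lemma zero_comp_left:
  assumes "is_zero_arr C f" "f \<in> hom C X Y" "g \<in> hom C Y W"
  shows "is_zero_arr C (g \<cdot> f)"
proof -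
  obtain Z a b where Z: "is_zero_object C Z" "a \<in> hom C X Z" "b \<in> hom C Z Y" "f = b \<cdot> a"
    using assms(1,2) by (rule zero_arrD)
  have "g \<cdot> f = (g \<cdot> b) \<cdot> a"
    using comp_assoc[OF Z(2,3) assms(3)] Z(4) by simp
  then show ?thesis
    using zero_arrI[OF Z(1,2) comp_in_hom[OF Z(3) assms(3)]] by simp
qed

text \<open>
  Two factorizations may run through different zero objects; the unique arrow between these
  carries one factorization to the other.
\<close>
lemma zero_arr_unique:
  assumes "is_zero_arr C f" "f \<in> hom C X Y" "is_zero_arr C g" "g \<in> hom C X Y"
  shows "f = g"
proof -
  obtain Z a b where Z: "is_zero_object C Z" "a \<in> hom C X Z" "b \<in> hom C Z Y" "f = b \<cdot> a"
    using assms(1,2) by (rule zero_arrD)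
  obtain Z' a' b' where Z': "is_zero_object C Z'" "a' \<in> hom C X Z'" "b' \<in> hom C Z' Y"
      "g = b' \<cdot> a'"
    using assms(3,4) by (rule zero_arrD)
  obtain s where s: "s \<in> hom C Z Z'"
    using zero_object_terminal[OF Z'(1) hom_Obj(2)[OF Z(2)]] by (elim ex1E)
  have "s \<cdot> a = a'"
    using zero_object_terminal[OF Z'(1) hom_Obj(1)[OF Z(2)]] comp_in_hom[OF Z(2) s] Z'(2)
    by (elim ex1E) metis
  moreover have "b' \<cdot> s = b"
    using zero_object_initial[OF Z(1) hom_Obj(2)[OF Z(3)]] comp_in_hom[OF s Z'(3)] Z(3)
    by (elim ex1E) metis
  ultimately show ?thesis
    using comp_assoc[OF Z(2) s Z'(3)] Z(4) Z'(4) by simp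
qed

end

lemma (in pointed_category) zero_arr_exists:
  assumes "X \<in> Obj C" "Y \<in> Obj C"
  obtains z where "z \<in> hom C X Y" "is_zero_arr C z"
proof -
  obtain Z where Z: "is_zero_object C Z"
    using has_zero_object by blast
  obtain a where a: "a \<in> hom C X Z"
    using zero_object_terminal[OF Z assms(1)] by (elim ex1E)
  obtain b where b: "b \<in> hom C Z Y"
    using zero_object_initial[OF Z assms(2)] by (elim ex1E)
  show ?thesis
    using that[OF comp_in_hom[OF a b] zero_arrI[OF Z a b]] .
qed

context pointed_category
begin

lemma monic_reflects_zero:
  assumes "monic C m" "m \<in> hom C X Y" "s \<in> hom C W X" "is_zero_arr C (m \<cdot> s)"
  shows "is_zero_arr C s"
proof -
  obtain z where z: "z \<in> hom C W X" "is_zero_arr C z"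
    using zero_arr_exists[OF hom_Obj[OF assms(3)]] by blast
  have "m \<cdot> s = m \<cdot> z"
    using zero_arr_unique[OF assms(4) comp_in_hom[OF assms(3,2)]
        zero_comp_left[OF z(2,1) assms(2)] comp_in_hom[OF z(1) assms(2)]] .
  then show ?thesis
    using monicD[OF assms(1-3) z(1)] z(2) by simp
qed

lemma epic_reflects_zero:
  assumes "epic C e" "e \<in> hom C X Y" "s \<in> hom C Y W" "is_zero_arr C (s \<cdot> e)"
  shows "is_zero_arr C s"
proof -
  obtain z where z: "z \<in> hom C Y W" "is_zero_arr C z"
    using zero_arr_exists[OF hom_Obj[OF assms(3)]] by blast
  have "s \<cdot> e = z \<cdot> e"
    using zero_arr_unique[OF assms(4) comp_in_hom[OF assms(2,3)]
        zero_comp_right[OF z(2,1) assms(2)] comp_in_hom[OF assms(2) z(1)]] .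
  then show ?thesis
    using epicD[OF assms(1-3) z(1)] z(2) by simp
qed

end

section \<open>Kernels and cokernels\<close>

context category
begin

text \<open>
  Over an arrow known to be monic (epic), only the existence half of the universal property of a
  kernel (cokernel) has content.
\<close>

lemma is_kernelI:
  assumes "f \<in> hom C X Y" "k \<in> hom C K X" "is_zero_arr C (f \<cdot> k)" "monic C k"
    and "\<And>W h. h \<in> hom C W X \<Longrightarrow> is_zero_arr C (f \<cdot> h) \<Longrightarrow> \<exists>t \<in> hom C W K. k \<cdot> t = h"
  shows "is_kernel C f k"
  unfolding is_kernel_def
proof (intro conjI allI ballI impI)
  fix W h assume h: "h \<in> hom C W (Dom C f)" "is_zero_arr C (f \<cdot> h)"
  have "h \<in> hom C W X"
    using h(1) assms(1) by (simp add: in_hom_iff)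
  then obtain t where t: "t \<in> hom C W K" "k \<cdot> t = h"
    using assms(5)[OF _ h(2)] by blast
  show "\<exists>!t. t \<in> hom C W (Dom C k) \<and> k \<cdot> t = h"
  proof (rule ex1I[of _ t])
    show "t \<in> hom C W (Dom C k) \<and> k \<cdot> t = h"
      using t assms(2) by (simp add: in_hom_iff)
    show "s = t" if "s \<in> hom C W (Dom C k) \<and> k \<cdot> s = h" for s
      using monicD[OF assms(4,2)] that t assms(2) by (simp add: in_hom_iff)
  qed
qed (use assms(1-3) in \<open>auto simp: in_hom_iff\<close>)

lemma is_cokernelI:
  assumes "f \<in> hom C X Y" "q \<in> hom C Y Q" "is_zero_arr C (q \<cdot> f)" "epic C q"
    and "\<And>W h. h \<in> hom C Y W \<Longrightarrow> is_zero_arr C (h \<cdot> f) \<Longrightarrow> \<exists>t \<in> hom C Q W. t \<cdot> q = h"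
  shows "is_cokernel C f q"
  unfolding is_cokernel_def
proof (intro conjI allI ballI impI)
  fix W h assume h: "h \<in> hom C (Cod C f) W" "is_zero_arr C (h \<cdot> f)"
  have "h \<in> hom C Y W"
    using h(1) assms(1) by (simp add: in_hom_iff)
  then obtain t where t: "t \<in> hom C Q W" "t \<cdot> q = h"
    using assms(5)[OF _ h(2)] by blast
  show "\<exists>!t. t \<in> hom C (Cod C q) W \<and> t \<cdot> q = h"
  proof (rule ex1I[of _ t])
    show "t \<in> hom C (Cod C q) W \<and> t \<cdot> q = h"
      using t assms(2) by (simp add: in_hom_iff)
    show "s = t" if "s \<in> hom C (Cod C q) W \<and> s \<cdot> q = h" for s
      using epicD[OF assms(4,2)] that t assms(2) by (simp add: in_hom_iff)
  qed
qed (use assms(1-3) in \<open>auto simp: in_hom_iff\<close>)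

lemma kernel_hom:
  assumes "is_kernel C f k"
  shows "f \<in> hom C (Cod C k) (Cod C f)" "k \<in> hom C (Dom C k) (Cod C k)"
  using assms by (simp_all add: is_kernel_def in_hom_iff)

lemma cokernel_hom:
  assumes "is_cokernel C f q"
  shows "f \<in> hom C (Dom C f) (Dom C q)" "q \<in> hom C (Dom C q) (Cod C q)"
  using assms by (simp_all add: is_cokernel_def in_hom_iff)

lemma kernel_zero: "is_kernel C f k \<Longrightarrow> is_zero_arr C (f \<cdot> k)"
  by (simp add: is_kernel_def)

lemma cokernel_zero: "is_cokernel C f q \<Longrightarrow> is_zero_arr C (q \<cdot> f)"
  by (simp add: is_cokernel_def)

lemma kernel_factor:
  assumes "is_kernel C f k" "k \<in> hom C K X" "h \<in> hom C W X" "is_zero_arr C (f \<cdot> h)"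
  obtains t where "t \<in> hom C W K" "k \<cdot> t = h"
proof -
  have "h \<in> hom C W (Dom C f)"
    using assms(1-3) by (simp add: is_kernel_def in_hom_iff)
  then have "\<exists>!t. t \<in> hom C W (Dom C k) \<and> k \<cdot> t = h"
    using assms(1,4) unfolding is_kernel_def by blast
  moreover have "Dom C k = K"
    using assms(2) by (simp add: in_hom_iff)
  ultimately show ?thesis
    using that by blast
qed

lemma cokernel_factor:
  assumes "is_cokernel C f q" "q \<in> hom C Y Q" "h \<in> hom C Y W" "is_zero_arr C (h \<cdot> f)"
  obtains t where "t \<in> hom C Q W" "t \<cdot> q = h"
proof -
  have "h \<in> hom C (Cod C f) W"
    using assms(1-3) by (simp add: is_cokernel_def in_hom_iff)
  then have "\<exists>!t. t \<in> hom C (Cod C q) W \<and> t \<cdot> q = h"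
    using assms(1,4) unfolding is_cokernel_def by blast
  moreover have "Cod C q = Q"
    using assms(2) by (simp add: in_hom_iff)
  ultimately show ?thesis
    using that by blast
qed

lemma kernel_monic:
  assumes "is_kernel C f k"
  shows "monic C k"
  unfolding monic_def
proof (intro conjI allI ballI impI)
  note f = kernel_hom(1)[OF assms] and k = kernel_hom(2)[OF assms]
  show "k \<in> Arr C" using k by (simp add: in_hom_iff)
  fix X s t assume s: "s \<in> hom C X (Dom C k)" and t: "t \<in> hom C X (Dom C k)"
    and eq: "k \<cdot> s = k \<cdot> t"
  have "is_zero_arr C (f \<cdot> (k \<cdot> s))"
    using zero_comp_right[OF kernel_zero[OF assms] comp_in_hom[OF k f] s] comp_assoc[OF s k f]
    by simp
  moreover have "k \<cdot> s \<in> hom C X (Dom C f)"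
    using comp_in_hom[OF s k] f by (simp add: in_hom_iff)
  ultimately have "\<exists>!r. r \<in> hom C X (Dom C k) \<and> k \<cdot> r = k \<cdot> s"
    using assms unfolding is_kernel_def by blast
  then show "s = t"
    using s t eq by metis
qed

lemma cokernel_epic:
  assumes "is_cokernel C f q"
  shows "epic C q"
  unfolding epic_def
proof (intro conjI allI ballI impI)
  note f = cokernel_hom(1)[OF assms] and q = cokernel_hom(2)[OF assms]
  show "q \<in> Arr C" using q by (simp add: in_hom_iff)
  fix Y s t assume s: "s \<in> hom C (Cod C q) Y" and t: "t \<in> hom C (Cod C q) Y"
    and eq: "s \<cdot> q = t \<cdot> q"
  have "is_zero_arr C ((s \<cdot> q) \<cdot> f)"
    using zero_comp_left[OF cokernel_zero[OF assms] comp_in_hom[OF f q] s] comp_assoc[OF f q s]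
    by simp
  moreover have "s \<cdot> q \<in> hom C (Cod C f) Y"
    using comp_in_hom[OF q s] f by (simp add: in_hom_iff)
  ultimately have "\<exists>!r. r \<in> hom C (Cod C q) Y \<and> r \<cdot> q = s \<cdot> q"
    using assms unfolding is_cokernel_def by blast
  then show "s = t"
    using s t eq by metis
qed

lemma epic_comp:
  assumes "epic C q" "q \<in> hom C X Y" "epic C c" "c \<in> hom C Y Z"
  shows "epic C (c \<cdot> q)"
  unfolding epic_def
proof (intro conjI allI ballI impI)
  note cq = comp_in_hom[OF assms(2,4)]
  show "c \<cdot> q \<in> Arr C" using cq by (simp add: in_hom_iff)
  fix W s t assume "s \<in> hom C (Cod C (c \<cdot> q)) W" "t \<in> hom C (Cod C (c \<cdot> q)) W"
    and eq: "s \<cdot> c \<cdot> q = t \<cdot> c \<cdot> q"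
  then have s: "s \<in> hom C Z W" and t: "t \<in> hom C Z W"
    using cq by (auto simp: in_hom_iff)
  have "(s \<cdot> c) \<cdot> q = (t \<cdot> c) \<cdot> q"
    using comp_assoc[OF assms(2,4) s] comp_assoc[OF assms(2,4) t] eq by simp
  then have "s \<cdot> c = t \<cdot> c"
    using epicD[OF assms(1,2)] comp_in_hom[OF assms(4) s] comp_in_hom[OF assms(4) t] by blast
  then show "s = t"
    using epicD[OF assms(3,4) s t] by blast
qed

lemma normal_mono_kernel_of_cokernel:
  assumes "normal_mono C k" "is_cokernel C k q"
  shows "is_kernel C q k"
proof -
  obtain f where f: "is_kernel C f k"
    using assms(1) unfolding normal_mono_def by blast
  note k = kernel_hom(2)[OF f] and fh = kernel_hom(1)[OF f]
  have q: "q \<in> hom C (Cod C k) (Cod C q)"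
    using assms(2) by (simp add: is_cokernel_def in_hom_iff)
  (* f kills k, so f factors through q, and whatever q kills is killed by f. *)
  obtain r where r: "r \<in> hom C (Cod C q) (Cod C f)" "r \<cdot> q = f"
    using cokernel_factor[OF assms(2) q fh kernel_zero[OF f]] by blast
  show ?thesis
  proof (rule is_kernelI[OF q k cokernel_zero[OF assms(2)] kernel_monic[OF f]])
    fix W h assume h: "h \<in> hom C W (Cod C k)" "is_zero_arr C (q \<cdot> h)"
    have "is_zero_arr C (f \<cdot> h)"
      using zero_comp_left[OF h(2) comp_in_hom[OF h(1) q] r(1)] comp_assoc[OF h(1) q r(1)] r(2)
      by simp
    then show "\<exists>t \<in> hom C W (Dom C k). k \<cdot> t = h"
      using kernel_factor[OF f k h(1)] by blast
  qed
qed

lemma normal_epi_cokernel_of_kernel: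
  assumes "normal_epi C q" "is_kernel C q k"
  shows "is_cokernel C k q"
proof -
  obtain f where f: "is_cokernel C f q"
    using assms(1) unfolding normal_epi_def by blast
  note q = cokernel_hom(2)[OF f] and fh = cokernel_hom(1)[OF f]
  have k: "k \<in> hom C (Dom C k) (Dom C q)"
    using assms(2) by (simp add: is_kernel_def in_hom_iff)
  (* Dually, f factors through k. *)
  obtain r where r: "r \<in> hom C (Dom C f) (Dom C k)" "k \<cdot> r = f"
    using kernel_factor[OF assms(2) k fh cokernel_zero[OF f]] by blast
  show ?thesis
  proof (rule is_cokernelI[OF k q kernel_zero[OF assms(2)] cokernel_epic[OF f]])
    fix W h assume h: "h \<in> hom C (Dom C q) W" "is_zero_arr C (h \<cdot> k)"
    have "is_zero_arr C (h \<cdot> f)"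
      using zero_comp_right[OF h(2) comp_in_hom[OF k h(1)] r(1)] comp_assoc[OF r(1) k h(1)] r(2)
      by simp
    then show "\<exists>t \<in> hom C (Cod C q) W. t \<cdot> q = h"
      using cokernel_factor[OF f q h(1)] by blast
  qed
qed

lemma cokernel_unique_iso:
  assumes q: "is_cokernel C f q" and q': "is_cokernel C f q'"
  shows "\<exists>!i. i \<in> hom C (Cod C q) (Cod C q') \<and> is_iso C i \<and> i \<cdot> q = q'"
proof -
  let ?Y = "Cod C f"
  have qh: "q \<in> hom C ?Y (Cod C q)" and qh': "q' \<in> hom C ?Y (Cod C q')"
    using q q' by (simp_all add: is_cokernel_def in_hom_iff)
  obtain i where i: "i \<in> hom C (Cod C q) (Cod C q')" "i \<cdot> q = q'"
    using cokernel_factor[OF q qh qh' cokernel_zero[OF q']] by blast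
  obtain g where g: "g \<in> hom C (Cod C q') (Cod C q)" "g \<cdot> q' = q"
    using cokernel_factor[OF q' qh' qh cokernel_zero[OF q]] by blast
  have "(g \<cdot> i) \<cdot> q = Id C (Cod C q) \<cdot> q"
    using comp_assoc[OF qh i(1) g(1)] i(2) g(2) id_comp[OF qh] by simp
  then have gi: "g \<cdot> i = Id C (Cod C q)"
    using epicD[OF cokernel_epic[OF q] qh comp_in_hom[OF i(1) g(1)]
        id_in_hom[OF hom_Obj(2)[OF qh]]] by blast
  have "(i \<cdot> g) \<cdot> q' = Id C (Cod C q') \<cdot> q'"
    using comp_assoc[OF qh' g(1) i(1)] i(2) g(2) id_comp[OF qh'] by simp
  then have ig: "i \<cdot> g = Id C (Cod C q')"
    using epicD[OF cokernel_epic[OF q'] qh' comp_in_hom[OF g(1) i(1)]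
        id_in_hom[OF hom_Obj(2)[OF qh']]] by blast
  show ?thesis
  proof (rule ex1I[of _ i])
    show "i \<in> hom C (Cod C q) (Cod C q') \<and> is_iso C i \<and> i \<cdot> q = q'"
      using i is_isoI[OF i(1) g(1) gi ig] by blast
    show "i' = i" if "i' \<in> hom C (Cod C q) (Cod C q') \<and> is_iso C i' \<and> i' \<cdot> q = q'" for i'
      by (rule epicD[OF cokernel_epic[OF q] qh _ i(1)]) (use that i(2) in simp_all)
  qed
qed

lemma kernel_comp_iso:
  assumes k: "is_kernel C f k" "k \<in> hom C K X"
    and i: "i \<in> hom C L K" "is_iso C i"
  shows "is_kernel C f (k \<cdot> i)"
proof -
  have f: "f \<in> hom C X (Cod C f)"
    using k by (simp add: is_kernel_def in_hom_iff)
  obtain g where g: "g \<in> hom C K L" "g \<cdot> i = Id C L" "i \<cdot> g = Id C K"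
    using i by (auto simp: is_iso_def in_hom_iff)
  note ki = comp_in_hom[OF i(1) k(2)]
  show ?thesis
  proof (rule is_kernelI[OF f ki])
    show "is_zero_arr C (f \<cdot> k \<cdot> i)"
      using zero_comp_right[OF kernel_zero[OF k(1)] comp_in_hom[OF k(2) f] i(1)]
        comp_assoc[OF i(1) k(2) f] by simp
    show "monic C (k \<cdot> i)"
      unfolding monic_def
    proof (intro conjI allI ballI impI)
      show "k \<cdot> i \<in> Arr C" using ki by (simp add: in_hom_iff)
      fix W s t assume "s \<in> hom C W (Dom C (k \<cdot> i))" "t \<in> hom C W (Dom C (k \<cdot> i))"
        and eq: "(k \<cdot> i) \<cdot> s = (k \<cdot> i) \<cdot> t"
      then have s: "s \<in> hom C W L" and t: "t \<in> hom C W L"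
        using ki by (auto simp: in_hom_iff)
      have "k \<cdot> i \<cdot> s = k \<cdot> i \<cdot> t"
        using eq comp_assoc[OF s i(1) k(2)] comp_assoc[OF t i(1) k(2)] by simp
      then have "i \<cdot> s = i \<cdot> t"
        using monicD[OF kernel_monic[OF k(1)] k(2)] comp_in_hom[OF s i(1)] comp_in_hom[OF t i(1)]
        by blast
      then show "s = t"
        using comp_assoc[OF s i(1) g(1)] comp_assoc[OF t i(1) g(1)] g(2) id_comp[OF s] id_comp[OF t]
        by simp
    qed
    fix W h assume h: "h \<in> hom C W X" "is_zero_arr C (f \<cdot> h)"
    then obtain t where t: "t \<in> hom C W K" "k \<cdot> t = h"
      using kernel_factor[OF k] by blast
    have "(k \<cdot> i) \<cdot> (g \<cdot> t) = k \<cdot> (i \<cdot> (g \<cdot> t))"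
      using comp_assoc[OF comp_in_hom[OF t(1) g(1)] i(1) k(2)] .
    also have "i \<cdot> (g \<cdot> t) = t"
      using comp_assoc[OF t(1) g(1) i(1)] g(3) id_comp[OF t(1)] by simp
    finally show "\<exists>s \<in> hom C W L. (k \<cdot> i) \<cdot> s = h"
      using t(2) comp_in_hom[OF t(1) g(1)] by blast
  qed
qed

end

section \<open>Kernels from finite limits\<close>

text \<open>
  The shape of a parallel pair: objects \<open>0\<close>, \<open>1\<close>, their identities, also named \<open>0\<close>, \<open>1\<close>, and
  two arrows \<open>2, 3 : 0 \<rightarrow> 1\<close>. In a composable pair one of the two arrows is an identity, hence the
  formula for composition.
\<close>
definition parallel_pair :: "(nat, nat) cat" where
  "parallel_pair = \<lparr>Obj = {0, 1}, Arr = {0, 1, 2, 3},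
    Dom = (\<lambda>b. if b = 1 then 1 else 0), Cod = (\<lambda>b. if b = 0 then 0 else 1),
    Id = (\<lambda>i. i), Comp = (\<lambda>c b. if c \<le> 1 then b else c)\<rparr>"

lemma parallel_pair_simps [simp]:
  "Obj parallel_pair = {0, 1}" "Arr parallel_pair = {0, 1, 2, 3}"
  "Dom parallel_pair b = (if b = 1 then 1 else 0)" "Cod parallel_pair b = (if b = 0 then 0 else 1)"
  "Id parallel_pair i = i" "Comp parallel_pair c b = (if c \<le> 1 then b else c)"
  by (simp_all add: parallel_pair_def)

lemma in_hom_parallel_pair_iff:
  "b \<in> hom parallel_pair i j \<longleftrightarrow>
    b = 0 \<and> i = 0 \<and> j = 0 \<or> b = 1 \<and> i = 1 \<and> j = 1 \<or> b \<in> {2, 3} \<and> i = 0 \<and> j = 1"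
  by (auto simp: in_hom_iff)

lemma parallel_pair_category: "category parallel_pair"
  by unfold_locales (auto simp: in_hom_parallel_pair_iff)

lemma (in category) equalizer_exists:
  assumes "has_finite_limits C" and f: "f \<in> hom C X Y" and g: "g \<in> hom C X Y"
  obtains e E where "e \<in> hom C E X" "f \<cdot> e = g \<cdot> e" "monic C e"
    "\<forall>W. \<forall>h \<in> hom C W X. f \<cdot> h = g \<cdot> h \<longrightarrow> (\<exists>t \<in> hom C W E. e \<cdot> t = h)"
proof -
  define FO :: "nat \<Rightarrow> 'o" where "FO i = (if i = 0 then X else Y)" for i
  define FA :: "nat \<Rightarrow> 'a" where
    "FA b = (if b = 0 then Id C X else if b = 1 then Id C Y else if b = 2 then f else g)" for b
  note XY = hom_Obj[OF f]
  note ids = id_in_hom[OF XY(1)] id_in_hom[OF XY(2)]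
  have fun_F: "is_functor parallel_pair C FO FA"
    using f g XY ids comp_id[OF f] comp_id[OF g] id_comp[OF f] id_comp[OF g]
      comp_id[OF ids(1)] comp_id[OF ids(2)]
    by (simp add: is_functor_def FO_def FA_def)
  have "finite (Obj parallel_pair)" "finite (Arr parallel_pair)"
    by simp_all
  then obtain E l where lim: "is_limit parallel_pair C FO FA E l"
    using assms(1) parallel_pair_category fun_F unfolding has_finite_limits_def by blast
  have cone_iff: "is_cone parallel_pair C FO FA W k \<longleftrightarrow>
      k 0 \<in> hom C W X \<and> k 1 \<in> hom C W Y \<and> f \<cdot> k 0 = k 1 \<and> g \<cdot> k 0 = k 1" for W k
    using id_comp[of "k 0" W X] id_comp[of "k 1" W Y] hom_Obj[of "k 0" W X]
    by (auto simp: is_cone_def FO_def FA_def)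
  have cone: "l 0 \<in> hom C E X" "f \<cdot> l 0 = l 1" "g \<cdot> l 0 = l 1"
    using lim cone_iff unfolding is_limit_def by blast+
  have univ: "\<exists>!t. t \<in> hom C W E \<and> l 0 \<cdot> t = h"
    if h: "h \<in> hom C W X" "f \<cdot> h = g \<cdot> h" for W h
  proof -
    have "is_cone parallel_pair C FO FA W (\<lambda>i. if i = 0 then h else f \<cdot> h)"
      using h comp_in_hom[OF h(1) f] by (simp add: cone_iff)
    then have "\<exists>!t. t \<in> hom C W E \<and>
        (\<forall>i \<in> Obj parallel_pair. l i \<cdot> t = (if i = 0 then h else f \<cdot> h))"
      using lim unfolding is_limit_def by blast
    moreover have "(\<forall>i \<in> Obj parallel_pair. l i \<cdot> t = (if i = 0 then h else f \<cdot> h)) \<longleftrightarrow> l 0 \<cdot> t = h"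
      if "t \<in> hom C W E" for t
      using comp_assoc[OF that cone(1) f] cone(2) by auto
    ultimately show ?thesis
      by (auto cong: conj_cong)
  qed
  have "monic C (l 0)"
    unfolding monic_def
  proof (intro conjI allI ballI impI)
    show "l 0 \<in> Arr C" using cone(1) by (simp add: in_hom_iff)
    fix W s t assume "s \<in> hom C W (Dom C (l 0))" "t \<in> hom C W (Dom C (l 0))"
      and eq: "l 0 \<cdot> s = l 0 \<cdot> t"
    then have s: "s \<in> hom C W E" and t: "t \<in> hom C W E"
      using cone(1) by (auto simp: in_hom_iff)
    have "f \<cdot> l 0 \<cdot> s = g \<cdot> l 0 \<cdot> s"
      using comp_assoc[OF s cone(1) f] comp_assoc[OF s cone(1) g] cone(2,3) by simp
    then show "s = t"
      using univ[OF comp_in_hom[OF s cone(1)]] s t eq by metis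
  qed
  then show ?thesis
    using that[OF cone(1)] cone(2,3) univ by (metis (no_types, lifting))
qed

lemma (in pointed_category) kernel_exists:
  assumes "has_finite_limits C" and f: "f \<in> hom C X Y"
  obtains k where "is_kernel C f k"
proof -
  (* A kernel is an equalizer with the zero arrow. *)
  obtain z where z: "z \<in> hom C X Y" "is_zero_arr C z"
    using zero_arr_exists[OF hom_Obj[OF f]] by blast
  obtain e E where e: "e \<in> hom C E X" "f \<cdot> e = z \<cdot> e" "monic C e"
      "\<forall>W. \<forall>h \<in> hom C W X. f \<cdot> h = z \<cdot> h \<longrightarrow> (\<exists>t \<in> hom C W E. e \<cdot> t = h)"
    by (rule equalizer_exists[OF assms(1) f z(1)])
  have "is_kernel C f e"
  proof (rule is_kernelI[OF f e(1) _ e(3)])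
    show "is_zero_arr C (f \<cdot> e)"
      using zero_comp_right[OF z(2,1) e(1)] e(2) by simp
    fix W h assume h: "h \<in> hom C W X" "is_zero_arr C (f \<cdot> h)"
    have "f \<cdot> h = z \<cdot> h"
      using zero_arr_unique[OF h(2) comp_in_hom[OF h(1) f] zero_comp_right[OF z(2,1) h(1)]
          comp_in_hom[OF h(1) z(1)]] .
    then show "\<exists>t \<in> hom C W E. e \<cdot> t = h"
      using e(4) h(1) by blast
  qed
  then show ?thesis using that by blast
qed

section \<open>The third isomorphism theorem\<close>

text \<open>
  Inverse image of a kernel: an arrow into \<open>A\<close> whose composite with \<open>q\<close> lands in \<open>ker p\<close> is one
  killed by \<open>p \<cdot> q\<close>.
\<close>
lemma (in category) pullback_of_kernel:
  assumes q: "q \<in> hom C A B" and p: "p \<in> hom C B D"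
    and k: "is_kernel C p k" "k \<in> hom C K B"
    and m: "is_kernel C (p \<cdot> q) m" "m \<in> hom C M A"
    and e: "e \<in> hom C M K" "k \<cdot> e = q \<cdot> m"
  shows "is_pullback C q k m e"
proof -
  have univ: "\<exists>!t. t \<in> hom C X M \<and> m \<cdot> t = h \<and> e \<cdot> t = r"
    if h: "h \<in> hom C X A" and r: "r \<in> hom C X K" and eq: "q \<cdot> h = k \<cdot> r" for X h r
  proof -
    have "(p \<cdot> q) \<cdot> h = (p \<cdot> k) \<cdot> r"
      using comp_assoc[OF h q p] comp_assoc[OF r k(2) p] eq by simp
    then have "is_zero_arr C ((p \<cdot> q) \<cdot> h)"
      using zero_comp_right[OF kernel_zero[OF k(1)] comp_in_hom[OF k(2) p] r] by simp
    then obtain t where t: "t \<in> hom C X M" "m \<cdot> t = h"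
      using kernel_factor[OF m h] by blast
    have "k \<cdot> e \<cdot> t = k \<cdot> r"
      using comp_assoc[OF t(1) e(1) k(2)] comp_assoc[OF t(1) m(2) q] e(2) t(2) eq by simp
    then have "e \<cdot> t = r"
      using monicD[OF kernel_monic[OF k(1)] k(2) comp_in_hom[OF t(1) e(1)] r] by blast
    moreover have "s = t" if "s \<in> hom C X M" "m \<cdot> s = h" for s
      by (rule monicD[OF kernel_monic[OF m(1)] m(2) that(1) t(1)]) (use that(2) t(2) in simp)
    ultimately show ?thesis
      using t by blast
  qed
  have ends: "Dom C q = A" "Dom C k = K" "Dom C m = M"
    using q k(2) m(2) by (simp_all add: in_hom_iff)
  show ?thesis
    unfolding is_pullback_def ends
  proof (intro conjI allI ballI impI)
    show "\<exists>!t. t \<in> hom C X M \<and> m \<cdot> t = h \<and> e \<cdot> t = r"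
      if "h \<in> hom C X A" "r \<in> hom C X K" "q \<cdot> h = k \<cdot> r" for X h r
      using univ[OF that] .
  qed (use q k(2) m(2) e in \<open>simp_all add: in_hom_iff\<close>)
qed

text \<open>
  Restricting \<open>f\<close> to a subobject \<open>M\<close> that contains \<open>ker f\<close> loses none of the kernel: what \<open>f \<cdot> m\<close>
  kills factors through \<open>ker f\<close> after \<open>m\<close>, and already before it since \<open>m\<close> is monic.
\<close>
lemma (in category) kernel_of_restriction:
  assumes n: "is_kernel C f (m \<cdot> j)" and m: "monic C m" "m \<in> hom C M A"
    and j: "j \<in> hom C N M" and f: "f \<in> hom C A B"
  shows "is_kernel C (f \<cdot> m) j"
proof (rule is_kernelI[OF comp_in_hom[OF m(2) f] j])
  note mj = comp_in_hom[OF j m(2)]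
  show "is_zero_arr C ((f \<cdot> m) \<cdot> j)"
    using kernel_zero[OF n] comp_assoc[OF j m(2) f] by simp
  show "monic C j"
    unfolding monic_def
  proof (intro conjI allI ballI impI)
    show "j \<in> Arr C" using j by (simp add: in_hom_iff)
    fix W s t assume "s \<in> hom C W (Dom C j)" "t \<in> hom C W (Dom C j)" and eq: "j \<cdot> s = j \<cdot> t"
    then have s: "s \<in> hom C W N" and t: "t \<in> hom C W N"
      using j by (auto simp: in_hom_iff)
    have "(m \<cdot> j) \<cdot> s = (m \<cdot> j) \<cdot> t"
      using comp_assoc[OF s j m(2)] comp_assoc[OF t j m(2)] eq by simp
    then show "s = t"
      using monicD[OF kernel_monic[OF n] mj s t] by blast
  qed
  fix W h assume h: "h \<in> hom C W M" "is_zero_arr C ((f \<cdot> m) \<cdot> h)"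
  have "is_zero_arr C (f \<cdot> (m \<cdot> h))"
    using h(2) comp_assoc[OF h(1) m(2) f] by simp
  then obtain t where t: "t \<in> hom C W N" "(m \<cdot> j) \<cdot> t = m \<cdot> h"
    using kernel_factor[OF n mj comp_in_hom[OF h(1) m(2)]] by blast
  have "j \<cdot> t = h"
    using monicD[OF m comp_in_hom[OF t(1) j] h(1)] t(2) comp_assoc[OF t(1) j m(2)] by simp
  then show "\<exists>t \<in> hom C W N. j \<cdot> t = h"
    using t(1) by blast
qed

text \<open>Postcomposition with a monic does not change which arrows are killed.\<close>
lemma (in pointed_category) kernel_cancel_monic:
  assumes j: "is_kernel C (k \<cdot> e) j" and k: "monic C k" "k \<in> hom C K B" and e: "e \<in> hom C M K"
  shows "is_kernel C e j"
proof -
  note ke = comp_in_hom[OF e k(2)]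
  have jh: "j \<in> hom C (Dom C j) M"
    using j ke by (simp add: is_kernel_def in_hom_iff)
  show ?thesis
  proof (rule is_kernelI[OF e jh _ kernel_monic[OF j]])
    show "is_zero_arr C (e \<cdot> j)"
      using monic_reflects_zero[OF k comp_in_hom[OF jh e]] kernel_zero[OF j]
        comp_assoc[OF jh e k(2)] by simp
    fix W h assume h: "h \<in> hom C W M" "is_zero_arr C (e \<cdot> h)"
    have "is_zero_arr C ((k \<cdot> e) \<cdot> h)"
      using zero_comp_left[OF h(2) comp_in_hom[OF h(1) e] k(2)] comp_assoc[OF h(1) e k(2)] by simp
    then show "\<exists>t \<in> hom C W (Dom C j). j \<cdot> t = h"
      using kernel_factor[OF j jh h(1)] by blast
  qed
qed

text \<open>
  Quotienting first by \<open>N\<close> and then by the image of \<open>M\<close> in \<open>A/N\<close> is quotienting by \<open>M\<close>.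
  Precomposing with the epic \<open>e : M \<rightarrow> U\<close> does not affect whether an arrow kills \<open>u\<close>.
\<close>
lemma (in pointed_category) cokernel_of_comp:
  assumes m: "m \<in> hom C M A" and j: "j \<in> hom C N M"
    and q: "is_cokernel C (m \<cdot> j) q" "q \<in> hom C A B"
    and e: "epic C e" "e \<in> hom C M U"
    and u: "u \<in> hom C U B" "u \<cdot> e = q \<cdot> m"
    and c: "is_cokernel C u c" "c \<in> hom C B D"
  shows "is_cokernel C m (c \<cdot> q)"
proof (rule is_cokernelI[OF m comp_in_hom[OF q(2) c(2)]])
  have "(c \<cdot> q) \<cdot> m = (c \<cdot> u) \<cdot> e"
    using comp_assoc[OF m q(2) c(2)] comp_assoc[OF e(2) u(1) c(2)] u(2) by simp
  then show "is_zero_arr C ((c \<cdot> q) \<cdot> m)"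
    using zero_comp_right[OF cokernel_zero[OF c(1)] comp_in_hom[OF u(1) c(2)] e(2)] by simp
  show "epic C (c \<cdot> q)"
    using epic_comp[OF cokernel_epic[OF q(1)] q(2) cokernel_epic[OF c(1)] c(2)] .
  fix W h assume h: "h \<in> hom C A W" "is_zero_arr C (h \<cdot> m)"
  have "is_zero_arr C (h \<cdot> (m \<cdot> j))"
    using zero_comp_right[OF h(2) comp_in_hom[OF m h(1)] j] comp_assoc[OF j m h(1)] by simp
  then obtain r where r: "r \<in> hom C B W" "r \<cdot> q = h"
    using cokernel_factor[OF q h(1)] by blast
  have "(r \<cdot> u) \<cdot> e = h \<cdot> m"
    using comp_assoc[OF e(2) u(1) r(1)] comp_assoc[OF m q(2) r(1)] u(2) r(2) by simp
  then have "is_zero_arr C (r \<cdot> u)"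
    using epic_reflects_zero[OF e comp_in_hom[OF u(1) r(1)]] h(2) by simp
  then obtain s where s: "s \<in> hom C D W" "s \<cdot> c = r"
    using cokernel_factor[OF c r(1)] by blast
  then have "s \<cdot> c \<cdot> q = h"
    using comp_assoc[OF q(2) c(2) s(1)] r(2) by simp
  then show "\<exists>t \<in> hom C D W. t \<cdot> c \<cdot> q = h"
    using s(1) by blast
qed

text \<open>
  This is where pullback stability enters: \<open>M\<close> is the inverse image of \<open>ker (A/N \<rightarrow> A/M)\<close> along the
  normal epimorphism \<open>A \<rightarrow> A/N\<close>, so \<open>M\<close> maps onto that kernel by a normal epimorphism, with
  kernel \<open>j\<close>; the kernel is therefore a copy of \<open>M/N\<close>.
\<close>
lemma (in prenormal_category) comparison_normal_mono:
  assumes m: "m \<in> hom C M A" "normal_mono C m" and j: "j \<in> hom C N M"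
    and n: "normal_mono C (m \<cdot> j)"
    and qn: "is_cokernel C (m \<cdot> j) qn" "qn \<in> hom C A B"
    and qj: "is_cokernel C j qj" "qj \<in> hom C M U"
    and u: "u \<in> hom C U B" "u \<cdot> qj = qn \<cdot> m"
  shows "normal_mono C u"
proof -
  have m_monic: "monic C m"
    using m(2) kernel_monic unfolding normal_mono_def by blast
  obtain qm where qm: "is_cokernel C m qm"
    using cokernels_of_kernels[OF m(2)] by blast
  have qmh: "qm \<in> hom C A (Cod C qm)"
    using qm m(1) by (simp add: is_cokernel_def in_hom_iff)
  have "is_zero_arr C (qm \<cdot> m \<cdot> j)"
    using zero_comp_right[OF cokernel_zero[OF qm] comp_in_hom[OF m(1) qmh] j]
      comp_assoc[OF j m(1) qmh] by simp
  then obtain p where p: "p \<in> hom C B (Cod C qm)" "p \<cdot> qn = qm"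
    using cokernel_factor[OF qn qmh] by blast
  obtain k where k: "is_kernel C p k"
    using kernel_exists[OF finite_limits p(1)] by blast
  define K where "K = Dom C k"
  have kh: "k \<in> hom C K B"
    using k p(1) by (simp add: is_kernel_def in_hom_iff K_def)
  have ker_m: "is_kernel C (p \<cdot> qn) m"
    using normal_mono_kernel_of_cokernel[OF m(2) qm] p(2) by simp
  have "is_zero_arr C (p \<cdot> qn \<cdot> m)"
    using kernel_zero[OF ker_m] comp_assoc[OF m(1) qn(2) p(1)] by simp
  then obtain e where e: "e \<in> hom C M K" "k \<cdot> e = qn \<cdot> m"
    using kernel_factor[OF k kh comp_in_hom[OF m(1) qn(2)]] by blast
  have "normal_epi C e"
    using normal_epi_pullback_stable[OF pullback_of_kernel[OF qn(2) p(1) k kh ker_m m(1) e]] qn(1)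
    unfolding normal_epi_def by blast
  moreover have "is_kernel C e j"
  proof (rule kernel_cancel_monic[OF _ kernel_monic[OF k] kh e(1)])
    show "is_kernel C (k \<cdot> e) j"
      using kernel_of_restriction[OF normal_mono_kernel_of_cokernel[OF n qn(1)] m_monic m(1) j qn(2)]
        e(2) by simp
  qed
  ultimately have "is_cokernel C j e"
    by (rule normal_epi_cokernel_of_kernel)
  then obtain i where "i \<in> hom C (Cod C qj) (Cod C e)" and i_iso: "is_iso C i" "i \<cdot> qj = e"
    using cokernel_unique_iso[OF qj(1)] by blast
  then have i: "i \<in> hom C U K"
    using qj(2) e(1) by (simp add: in_hom_iff)
  have "(k \<cdot> i) \<cdot> qj = u \<cdot> qj"
    using comp_assoc[OF qj(2) i kh] i_iso(2) e(2) u(2) by simp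
  then have "k \<cdot> i = u"
    using epicD[OF cokernel_epic[OF qj(1)] qj(2) comp_in_hom[OF i kh] u(1)] by blast
  then show ?thesis
    using kernel_comp_iso[OF k kh i i_iso(1)] unfolding normal_mono_def by blast
qed

theorem proposition2p10:
  fixes C :: "('o, 'a, 'z) cat_scheme" (structure)
  assumes "prenormal_category C"
    and "m \<in> hom C M A" and "normal_mono C m"
    and "n \<in> hom C N A" and "normal_mono C n"
    and "j \<in> hom C N M" and "n = m \<cdot> j"
  shows "normal_mono C j \<and>
    (\<forall>qj qn. is_cokernel C j qj \<longrightarrow> is_cokernel C n qn \<longrightarrow>
      (\<exists>!u. u \<in> hom C (Cod C qj) (Cod C qn) \<and> u \<cdot> qj = qn \<cdot> m) \<and>
      (\<forall>u. u \<in> hom C (Cod C qj) (Cod C qn) \<and> u \<cdot> qj = qn \<cdot> m \<longrightarrow>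
        normal_mono C u \<and>
        (\<forall>c qm. is_cokernel C u c \<longrightarrow> is_cokernel C m qm \<longrightarrow>
          (\<exists>!i. i \<in> hom C (Cod C c) (Cod C qm) \<and> is_iso C i \<and> i \<cdot> (c \<cdot> qn) = qm))))"
proof -
  interpret prenormal_category C by (rule assms(1))
  note m = assms(2) and j = assms(6) and n_eq = assms(7)
  have m_monic: "monic C m"
    using assms(3) kernel_monic unfolding normal_mono_def by blast
  have n: "normal_mono C (m \<cdot> j)"
    using assms(5,7) by simp
  have codom: "q \<in> hom C A (Cod C q)" if "is_cokernel C (m \<cdot> j) q" for q
    using that comp_in_hom[OF j m] by (simp add: is_cokernel_def in_hom_iff)
  have normal_j: "normal_mono C j"
  proof -
    obtain q where q: "is_cokernel C (m \<cdot> j) q"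
      using cokernels_of_kernels[OF n] by blast
    show ?thesis
      using kernel_of_restriction[OF normal_mono_kernel_of_cokernel[OF n q] m_monic m j codom[OF q]]
      unfolding normal_mono_def by blast
  qed
  have main: "(\<exists>!u. u \<in> hom C (Cod C qj) (Cod C qn) \<and> u \<cdot> qj = qn \<cdot> m) \<and>
      (\<forall>u. u \<in> hom C (Cod C qj) (Cod C qn) \<and> u \<cdot> qj = qn \<cdot> m \<longrightarrow>
        normal_mono C u \<and>
        (\<forall>c qm. is_cokernel C u c \<longrightarrow> is_cokernel C m qm \<longrightarrow>
          (\<exists>!i. i \<in> hom C (Cod C c) (Cod C qm) \<and> is_iso C i \<and> i \<cdot> (c \<cdot> qn) = qm)))"
    if qj: "is_cokernel C j qj" and qn: "is_cokernel C (m \<cdot> j) qn" for qj qn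
  proof (intro conjI allI impI)
    note qnh = codom[OF qn]
    have qjh: "qj \<in> hom C M (Cod C qj)"
      using qj j by (simp add: is_cokernel_def in_hom_iff)
    have "is_zero_arr C ((qn \<cdot> m) \<cdot> j)"
      using cokernel_zero[OF qn] comp_assoc[OF j m qnh] by simp
    then obtain u where "u \<in> hom C (Cod C qj) (Cod C qn)" "u \<cdot> qj = qn \<cdot> m"
      using cokernel_factor[OF qj qjh comp_in_hom[OF m qnh]] by blast
    then show "\<exists>!u. u \<in> hom C (Cod C qj) (Cod C qn) \<and> u \<cdot> qj = qn \<cdot> m"
      using epicD[OF cokernel_epic[OF qj] qjh] by metis
    fix u assume "u \<in> hom C (Cod C qj) (Cod C qn) \<and> u \<cdot> qj = qn \<cdot> m"
    then have u: "u \<in> hom C (Cod C qj) (Cod C qn)" "u \<cdot> qj = qn \<cdot> m"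
      by blast+
    show "normal_mono C u"
      using comparison_normal_mono[OF m assms(3) j n qn qnh qj qjh u] .
    fix c qm assume c: "is_cokernel C u c" and qm: "is_cokernel C m qm"
    have ch: "c \<in> hom C (Cod C qn) (Cod C c)"
      using c u(1) by (simp add: is_cokernel_def in_hom_iff)
    have "is_cokernel C m (c \<cdot> qn)"
      using cokernel_of_comp[OF m j qn qnh cokernel_epic[OF qj] qjh u c ch] .
    then show "\<exists>!i. i \<in> hom C (Cod C c) (Cod C qm) \<and> is_iso C i \<and> i \<cdot> (c \<cdot> qn) = qm"
      using cokernel_unique_iso[OF _ qm, of "c \<cdot> qn"] comp_in_hom[OF qnh ch]
      by (simp add: in_hom_iff)
  qed
  show ?thesis
    using normal_j main unfolding n_eq by blast
qed

end
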